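(* Let $K$ be a field, let $n\geq 3$ be an integer, let $S=K[x_1,\ldots,x_n]$, and let $J_n=(x_1x_2,\,x_2x_3,\ldots,x_{n-1}x_n,\,x_nx_1)\subset S$. Then: (1) if $n\equiv 0\pmod 3$ or $n\equiv 2\pmod 3$, then $\operatorname{sdepth}(S/J_n)=\left\lceil\frac{n-1}{3}\right\rceil$; (2) if $n\equiv 1\pmod 3$, then $\operatorname{sdepth}(S/J_n)\leq\left\lceil\frac{n}{3}\right\rceil$.
   Context: Let $M$ be a nonzero $\mathbb Z^n$-graded $S$-module. A Stanley decomposition of $M$ is a direct sum $\mathcal D: M=\bigoplus_{i=1}^r m_iK[Z_i]$ as $\mathbb Z^n$-graded $K$-vector spaces, where each $m_i\in M$ is homogeneous with respect to the $\mathbb Z^n$-grading, $Z_i\subset\{x_1,\ldots,x_n\}$, and $m_iK[Z_i]=\{um_i:\ u\in K[Z_i]\}\subset M$ is a free $K[Z_i]$-submodule of $M$. Put $\operatorname{sdepth}(\mathcal D)=\min_{i}|Z_i|$. The Stanley depth $\operatorname{sdepth}(M)$ is the maximum of $\operatorname{sdepth}(\mathcal D)$ over all Stanley decompositions $\mathcal D$ of $M$. *)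

theory Defs
  imports Complex_Main "HOL-Library.Poly_Mapping" "HOL-Library.FuncSet"
    "HOL-Algebra.QuotRing" "HOL-Algebra.Module"
begin

type_synonym 'k mpol = "(nat \<Rightarrow>\<^sub>0 nat) \<Rightarrow>\<^sub>0 'k"

text \<open>\<open>K[Z]\<close>, with the variable \<open>x\<^sub>i\<close> represented by its index \<open>i\<close>.\<close>

definition polys :: "nat set \<Rightarrow> ('k::zero) mpol set" where
  "polys Z = {p. \<forall>e\<in>Poly_Mapping.keys p. Poly_Mapping.keys e \<subseteq> Z}"

definition var :: "nat \<Rightarrow> ('k::zero_neq_one) mpol" where
  "var i = Poly_Mapping.single (Poly_Mapping.single i 1) 1"

definition poly_ring :: "nat \<Rightarrow> ('k::comm_ring_1) mpol ring" where
  "poly_ring n = \<lparr>carrier = polys {1..n}, mult = (*), one = 1, zero = 0, add = (+)\<rparr>"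

definition cycle_ideal :: "nat \<Rightarrow> ('k::comm_ring_1) mpol set" where
  "cycle_ideal n = Idl\<^bsub>poly_ring n\<^esub>
     ({var i * var (i + 1) | i. i \<in> {1..<n}} \<union> {var n * var 1})"

definition Zn :: "nat \<Rightarrow> (nat \<Rightarrow> int) set" where
  "Zn n = {a. \<forall>i. i \<notin> {1..n} \<longrightarrow> a i = 0}"

text \<open>
  A \<open>\<int>\<^sup>n\<close>-graded module over \<open>poly_ring n\<close> is given below by a module \<open>M\<close> together with the family
  \<open>gr\<close> of its homogeneous components, \<open>gr a\<close> being the component of degree \<open>a \<in> Zn n\<close>.
\<close>

definition homogeneous ::
    "nat \<Rightarrow> ((nat \<Rightarrow> int) \<Rightarrow> 'm set) \<Rightarrow> 'm \<Rightarrow> bool" where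
  "homogeneous n gr m \<longleftrightarrow> (\<exists>a\<in>Zn n. m \<in> gr a)"

definition stanley_space ::
    "(('k::comm_ring_1) mpol, 'm) module \<Rightarrow> 'm \<Rightarrow> nat set \<Rightarrow> 'm set" where
  "stanley_space M m Z = {u \<odot>\<^bsub>M\<^esub> m | u. u \<in> polys Z}"

text \<open>
  A decomposition is a list of pairs \<open>(m\<^sub>i, Z\<^sub>i)\<close>. The condition \<open>u \<odot> m = 0 \<longrightarrow> u = 0\<close> says that
  \<open>m\<close> is a \<open>K[Z]\<close>-basis of \<open>mK[Z]\<close>. As every \<open>m\<^sub>i\<close> is homogeneous, the spaces \<open>m\<^sub>iK[Z\<^sub>i]\<close> are graded
  subspaces, so a direct sum of vector spaces is automatically one of graded vector spaces.
\<close>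

definition stanley_decomposition ::
    "nat \<Rightarrow> (('k::comm_ring_1) mpol, 'm) module \<Rightarrow> ((nat \<Rightarrow> int) \<Rightarrow> 'm set)
       \<Rightarrow> ('m \<times> nat set) list \<Rightarrow> bool" where
  "stanley_decomposition n M gr D \<longleftrightarrow>
     (\<forall>(m, Z) \<in> set D.
        m \<in> carrier M \<and> homogeneous n gr m \<and> Z \<subseteq> {1..n} \<and>
        (\<forall>u\<in>polys Z. u \<odot>\<^bsub>M\<^esub> m = \<zero>\<^bsub>M\<^esub> \<longrightarrow> u = 0)) \<and>
     (\<forall>x\<in>carrier M.
        \<exists>!v. v \<in> (\<Pi>\<^sub>E i\<in>{..<length D}. stanley_space M (fst (D ! i)) (snd (D ! i))) \<and>
             x = (\<Oplus>\<^bsub>M\<^esub>i\<in>{..<length D}. v i))"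

definition sdepth_decomposition :: "('m \<times> nat set) list \<Rightarrow> nat" where
  "sdepth_decomposition D = Min ((\<lambda>(m, Z). card Z) ` set D)"

definition sdepth ::
    "nat \<Rightarrow> (('k::comm_ring_1) mpol, 'm) module \<Rightarrow> ((nat \<Rightarrow> int) \<Rightarrow> 'm set) \<Rightarrow> nat" where
  "sdepth n M gr = Max {sdepth_decomposition D | D. stanley_decomposition n M gr D}"

text \<open>\<open>R/I\<close> as an \<open>R\<close>-module: \<open>r\<close> acts as multiplication by its class.\<close>

definition quotient_module :: "('a, 'b) ring_scheme \<Rightarrow> 'a set \<Rightarrow> ('a, 'a set) module" where
  "quotient_module R I =
     \<lparr>carrier = carrier (R Quot I), mult = mult (R Quot I), one = one (R Quot I),
      zero = zero (R Quot I), add = add (R Quot I),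
      smult = (\<lambda>r X. (I +>\<^bsub>R\<^esub> r) \<otimes>\<^bsub>R Quot I\<^esub> X)\<rparr>"

text \<open>
  The degree \<open>a\<close> component of \<open>S/I\<close> is the image of the degree \<open>a\<close> component of \<open>S\<close>; the latter
  is \<open>0\<close> if \<open>a\<close> has a negative entry.
\<close>

definition poly_component :: "nat \<Rightarrow> (nat \<Rightarrow> int) \<Rightarrow> ('k::comm_ring_1) mpol set" where
  "poly_component n a =
     {p \<in> polys {1..n}. \<forall>e\<in>Poly_Mapping.keys p. \<forall>i. int (Poly_Mapping.lookup e i) = a i}"

definition quotient_component ::
    "nat \<Rightarrow> ('k::comm_ring_1) mpol set \<Rightarrow> (nat \<Rightarrow> int) \<Rightarrow> ('k mpol) set set" where
  "quotient_component n I a = (\<lambda>p. I +>\<^bsub>poly_ring n\<^esub> p) ` poly_component n a"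

definition sdepth_quotient :: "nat \<Rightarrow> ('k::comm_ring_1) mpol set \<Rightarrow> nat" where
  "sdepth_quotient n I =
     sdepth n (quotient_module (poly_ring n) I) (quotient_component n I)"

end

theory Submission
  imports Defs
begin

text \<open>
  \<open>J\<^sub>n\<close> is spanned by the monomials whose support is not an independent set of the \<open>n\<close>-cycle, so \<open>S/J\<^sub>n\<close>
  has a \<open>K\<close>-basis consisting of the monomials with independent support.

  Lower bound: if intervals \<open>[A, B]\<close> partition the complex \<open>\<Delta>\<close> of independent sets, then the spaces
  \<open>x\<^sup>A K[B]\<close> form a Stanley decomposition. Deciding whether the last-but-one vertex of a path on
  \<open>m + 3\<close> vertices is used reduces it to the paths on \<open>m\<close> and \<open>m + 1\<close> vertices, joined with a point,
  and yields a partition with all \<open>|B| \<ge> \<lceil>m/3\<rceil>\<close> for the path on \<open>m\<close> vertices. Deciding whether vertex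
  \<open>n\<close> is used reduces the \<open>n\<close>-cycle to paths on \<open>n - 1\<close> and \<open>n - 3\<close> vertices.

  Upper bound: let \<open>F\<close> be a maximal independent set. Some Stanley space \<open>mK[Z]\<close> of a decomposition
  contains a multiple of \<open>m\<close> in which \<open>x\<^sup>F\<close> occurs; as \<open>mK[Z]\<close> is free, \<open>supp m \<union> Z\<close> is independent,
  and it contains \<open>F\<close>, so \<open>Z \<subseteq> F\<close>. The cycle has a maximal independent set with \<open>\<lceil>n/3\<rceil>\<close> elements.
\<close>

abbreviation keys :: "('a \<Rightarrow>\<^sub>0 'b::zero) \<Rightarrow> 'a set" where
  "keys \<equiv> Poly_Mapping.keys"

abbreviation lookup :: "('a \<Rightarrow>\<^sub>0 'b::zero) \<Rightarrow> 'a \<Rightarrow> 'b" where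
  "lookup \<equiv> Poly_Mapping.lookup"

abbreviation monom :: "(nat \<Rightarrow>\<^sub>0 nat) \<Rightarrow> 'k::comm_ring_1 mpol" where
  "monom e \<equiv> Poly_Mapping.single e 1"

section \<open>Polynomials\<close>

lemma keys_plus_nat: "keys (e + e' :: nat \<Rightarrow>\<^sub>0 nat) = keys e \<union> keys e'"
  by (auto simp: in_keys_iff lookup_add)

lemma monom_neq_0 [simp]: "(monom e :: 'k::comm_ring_1 mpol) \<noteq> 0"
  by (metis lookup_single_eq lookup_zero zero_neq_one)

text \<open>Adding \<open>a\<close> is injective on exponents, so in the convolution only the pair
  \<open>(e, a)\<close> contributes to the coefficient at \<open>e + a\<close>.\<close>

lemma lookup_mult_monom_add:
  "lookup (p * monom a :: 'k::comm_ring_1 mpol) (e + a) = lookup p e"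
proof -
  have "(\<Sum>q. lookup (monom a :: 'k mpol) q when e + a = l + q) = (1 when l = e)" for l
  proof -
    have "(\<lambda>q. lookup (monom a :: 'k mpol) q when e + a = l + q) = (\<lambda>q. (1 when l = e) when q = a)"
      by (auto simp: fun_eq_iff lookup_single when_def)
    then show ?thesis by (simp only: Sum_any_when_equal)
  qed
  then show ?thesis
    by (simp add: lookup_mult mult_when)
qed

lemma keys_mult_monom:
  "keys (p * monom a :: 'k::comm_ring_1 mpol) = (\<lambda>e. e + a) ` keys p"
proof
  show "keys (p * monom a) \<subseteq> (\<lambda>e. e + a) ` keys p"
    using keys_mult[of p "monom a"] by auto
  show "(\<lambda>e. e + a) ` keys p \<subseteq> keys (p * monom a)"
    by (auto simp: in_keys_iff lookup_mult_monom_add)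
qed

text \<open>Multiplication by a monomial merely translates the set of exponents. This yields
  freeness of the spaces \<open>x^A K[B]\<close> later on.\<close>

lemma mult_monom_eq_0_iff: "p * monom a = 0 \<longleftrightarrow> (p :: 'k::comm_ring_1 mpol) = 0"
proof -
  have "p * monom a = 0 \<longleftrightarrow> keys (p * monom a) = {}" by (simp only: keys_eq_empty)
  also have "\<dots> \<longleftrightarrow> keys p = {}" by (simp add: keys_mult_monom)
  also have "\<dots> \<longleftrightarrow> p = 0" by (simp only: keys_eq_empty)
  finally show ?thesis .
qed

lemma sum_monomials: "(\<Sum>e\<in>keys p. Poly_Mapping.single e (lookup p e)) = p"
  by (rule poly_mapping_eqI)
    (auto simp: lookup_sum lookup_single when_def not_in_keys_iff_lookup_eq_zero)

text \<open>The exponent of the squarefree monomial \<open>x^A\<close>. The sum is 0 for infinite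
  \<open>A\<close>, whence the finiteness assumptions below.\<close>

definition set_exp :: "nat set \<Rightarrow> (nat \<Rightarrow>\<^sub>0 nat)" where
  "set_exp A = (\<Sum>i\<in>A. Poly_Mapping.single i 1)"

lemma lookup_set_exp: "finite A \<Longrightarrow> lookup (set_exp A) i = (1 when i \<in> A)"
  by (auto simp: set_exp_def lookup_sum lookup_single when_def)

lemma keys_set_exp [simp]: "finite A \<Longrightarrow> keys (set_exp A) = A"
  by (auto simp: in_keys_iff lookup_set_exp when_def split: if_splits)

text \<open>Subtraction is truncated, but \<open>x^A\<close> divides \<open>x^e\<close> here, so
  nothing is cut off.\<close>

lemma diff_add_set_exp:
  assumes "A \<subseteq> keys e" shows "e - set_exp A + set_exp A = e"
proof (rule poly_mapping_eqI)
  fix i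
  have "finite A" using assms by (rule finite_subset) simp
  then show "lookup (e - set_exp A + set_exp A) i = lookup e i"
    using assms by (auto simp: lookup_add lookup_minus lookup_set_exp when_def in_keys_iff subset_iff)
qed

section \<open>Closure properties of \<open>K[Z]\<close>\<close>

lemma polys_0 [simp]: "0 \<in> polys Z"
  and polys_1 [simp]: "(1 :: 'k::comm_ring_1 mpol) \<in> polys Z"
  by (auto simp: polys_def)

lemma polys_add: "p \<in> polys Z \<Longrightarrow> q \<in> polys Z \<Longrightarrow> (p + q :: 'k::comm_ring_1 mpol) \<in> polys Z"
  using keys_add[of p q] by (auto simp: polys_def subset_iff)

lemma polys_uminus: "p \<in> polys Z \<Longrightarrow> (- p :: 'k::comm_ring_1 mpol) \<in> polys Z"
  by (auto simp: polys_def in_keys_iff)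

lemma polys_diff: "p \<in> polys Z \<Longrightarrow> q \<in> polys Z \<Longrightarrow> (p - q :: 'k::comm_ring_1 mpol) \<in> polys Z"
  using polys_add[OF _ polys_uminus, of p Z q] by simp

lemma polys_sum:
  "(\<And>i. i \<in> I \<Longrightarrow> p i \<in> polys Z) \<Longrightarrow> (\<Sum>i\<in>I. p i :: 'k::comm_ring_1 mpol) \<in> polys Z"
  by (induction I rule: infinite_finite_induct) (auto intro: polys_add)

lemma polys_mult:
  assumes "p \<in> polys Z" "q \<in> polys Z" shows "(p * q :: 'k::comm_ring_1 mpol) \<in> polys Z"
  unfolding polys_def
proof (clarify)
  fix e x assume "e \<in> keys (p * q)" and x: "x \<in> keys e"
  then obtain a b where "e = a + b" "a \<in> keys p" "b \<in> keys q"
    using keys_mult[of p q] by blast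
  then show "x \<in> Z" using assms x by (auto simp: polys_def keys_plus_nat)
qed

lemma polys_mono: "Z \<subseteq> Z' \<Longrightarrow> polys Z \<subseteq> polys Z'"
  by (auto simp: polys_def)

lemma polys_single: "keys e \<subseteq> Z \<Longrightarrow> Poly_Mapping.single e c \<in> polys Z"
  by (auto simp: polys_def)

text \<open>The linear projection onto the span of the monomials with support in
  \<open>\<S>\<close>. For \<open>\<S> = {A..B}\<close> it extracts the component in
  \<open>x^A K[B]\<close>.\<close>

definition restrict_supports :: "nat set set \<Rightarrow> 'k::comm_ring_1 mpol \<Rightarrow> 'k mpol" where
  "restrict_supports \<S> p = Poly_Mapping.mapp (\<lambda>e c. c when keys e \<in> \<S>) p"

lemma lookup_restrict_supports:
  "lookup (restrict_supports \<S> p) e = (lookup p e when keys e \<in> \<S>)"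
  by (auto simp: restrict_supports_def lookup_mapp when_def in_keys_iff)

lemma keys_restrict_supports: "keys (restrict_supports \<S> p) = {e \<in> keys p. keys e \<in> \<S>}"
  by (auto simp: in_keys_iff lookup_restrict_supports)

text \<open>A monomial is \<open>x^A\<close> times a monomial of \<open>K[B]\<close> exactly if its
  support lies between \<open>A\<close> and \<open>B\<close>. Stanley spaces thereby become
  conditions on supports.\<close>

lemma multiples_set_exp_eq:
  assumes "A \<subseteq> B" "finite B"
  shows "{u * monom (set_exp A) | u. u \<in> polys B} =
    {q :: 'k::comm_ring_1 mpol. \<forall>e\<in>keys q. keys e \<in> {A..B}}"
proof (intro Set.equalityI subsetI)
  have fA: "finite A" using assms finite_subset by auto
  fix q :: "'k mpol" assume "q \<in> {u * monom (set_exp A) | u. u \<in> polys B}"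
  then show "q \<in> {q. \<forall>e\<in>keys q. keys e \<in> {A..B}}"
    using assms fA by (auto simp: keys_mult_monom keys_plus_nat polys_def subset_iff)
next
  have fA: "finite A" using assms finite_subset by auto
  fix q :: "'k mpol" assume "q \<in> {q. \<forall>e\<in>keys q. keys e \<in> {A..B}}"
  then have q: "A \<subseteq> keys e" "keys e \<subseteq> B" if "e \<in> keys q" for e using that by auto
  \<comment> \<open>The quotient of \<open>q\<close> by \<open>x^A\<close>, formed term by
    term.\<close>
  define u where "u = (\<Sum>e\<in>keys q. Poly_Mapping.single (e - set_exp A) (lookup q e))"
  have "u * monom (set_exp A) = (\<Sum>e\<in>keys q. Poly_Mapping.single (e - set_exp A + set_exp A) (lookup q e))"
    by (simp add: u_def sum_distrib_right mult_single)
  also have "\<dots> = (\<Sum>e\<in>keys q. Poly_Mapping.single e (lookup q e))"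
    by (intro sum.cong) (simp_all add: diff_add_set_exp q)
  also have "\<dots> = q" by (rule sum_monomials)
  finally have "q = u * monom (set_exp A)" by simp
  moreover have "u \<in> polys B" unfolding u_def
  proof (intro polys_sum polys_single subsetI)
    fix e i assume "e \<in> keys q" "i \<in> keys (e - set_exp A)"
    then show "i \<in> B" using q(2)[of e] by (auto simp: in_keys_iff lookup_minus subset_iff)
  qed
  ultimately show "q \<in> {u * monom (set_exp A) | u. u \<in> polys B}" by blast
qed

lemma cring_poly_ring: "cring (poly_ring n :: 'k::comm_ring_1 mpol ring)"
proof (rule cringI)
  show "abelian_group (poly_ring n :: 'k mpol ring)"
  proof (rule abelian_groupI)
    show "\<exists>y\<in>carrier (poly_ring n). y \<oplus>\<^bsub>poly_ring n\<^esub> x = \<zero>\<^bsub>poly_ring n\<^esub>"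
      if "x \<in> carrier (poly_ring n)" for x :: "'k mpol"
      using that by (intro bexI[of _ "- x"]) (auto simp: poly_ring_def polys_uminus)
  qed (auto simp: poly_ring_def polys_add algebra_simps)
  show "Group.comm_monoid (poly_ring n :: 'k mpol ring)"
    by (rule comm_monoidI) (auto simp: poly_ring_def polys_mult algebra_simps)
qed (auto simp: poly_ring_def algebra_simps)

section \<open>Quotients by ideals\<close>

abbreviation residue :: "nat \<Rightarrow> 'k::comm_ring_1 mpol set \<Rightarrow> 'k mpol \<Rightarrow> 'k mpol set" where
  "residue n I p \<equiv> I +>\<^bsub>poly_ring n\<^esub> p"

context
  fixes n :: nat and I :: "'k::comm_ring_1 mpol set"
  assumes I: "ideal I (poly_ring n)"
begin

interpretation ideal I "poly_ring n" by (rule I)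

lemma ideal_0: "0 \<in> I"
  using additive_subgroup.zero_closed[OF is_additive_subgroup] by (simp add: poly_ring_def)

lemma ideal_add: "p \<in> I \<Longrightarrow> q \<in> I \<Longrightarrow> p + q \<in> I"
  using additive_subgroup.a_closed[OF is_additive_subgroup, of p q] by (simp add: poly_ring_def)

lemma ideal_mult: "p \<in> I \<Longrightarrow> q \<in> polys {1..n} \<Longrightarrow> q * p \<in> I"
  using I_l_closed[of p q] by (simp add: poly_ring_def)

lemma ideal_uminus: "p \<in> I \<Longrightarrow> - p \<in> I"
  using ideal_mult[of p "- 1"] by (simp add: polys_uminus)

lemma ideal_sum: "(\<And>i. i \<in> A \<Longrightarrow> f i \<in> I) \<Longrightarrow> sum f A \<in> I"
  by (induction A rule: infinite_finite_induct) (auto simp: ideal_0 ideal_add)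

lemma residue_eq: "residue n I p = (\<lambda>h. h + p) ` I"
  by (auto simp: a_r_coset_def r_coset_def poly_ring_def)

lemma residue_eq_iff: "residue n I p = residue n I q \<longleftrightarrow> p - q \<in> I"
proof
  assume "residue n I p = residue n I q"
  then have "0 + p \<in> (\<lambda>h. h + q) ` I" using ideal_0 by (auto simp only: residue_eq)
  then show "p - q \<in> I" by auto
next
  have sub: "residue n I p \<subseteq> residue n I q" if "p - q \<in> I" for p q
  proof
    fix x assume "x \<in> residue n I p"
    then obtain h where "h \<in> I" "x = (h + (p - q)) + q" by (auto simp: residue_eq)
    then show "x \<in> residue n I q" unfolding residue_eq using that by (blast intro: ideal_add)
  qed
  assume "p - q \<in> I"
  then show "residue n I p = residue n I q"
    using sub[of p q] sub[of q p] ideal_uminus[of "p - q"] by auto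
qed

section \<open>The module \<open>S/I\<close>, computed on representatives\<close>

abbreviation (input) "M \<equiv> quotient_module (poly_ring n) I"

lemma carrier_quotient_module: "carrier M = residue n I ` polys {1..n}"
  by (auto simp: quotient_module_def FactRing_def A_RCOSETS_def' poly_ring_def)

lemma zero_quotient_module: "\<zero>\<^bsub>M\<^esub> = residue n I 0"
  by (simp add: quotient_module_def FactRing_def residue_eq)

lemma add_quotient_module:
  "p \<in> polys {1..n} \<Longrightarrow> q \<in> polys {1..n} \<Longrightarrow>
    residue n I p \<oplus>\<^bsub>M\<^esub> residue n I q = residue n I (p + q)"
  using a_rcos_sum[of p q] by (simp add: quotient_module_def FactRing_def poly_ring_def)

lemma smult_quotient_module:
  "p \<in> polys {1..n} \<Longrightarrow> q \<in> polys {1..n} \<Longrightarrow>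
    p \<odot>\<^bsub>M\<^esub> residue n I q = residue n I (p * q)"
  using rcoset_mult_add[of p q] by (simp add: quotient_module_def FactRing_def poly_ring_def)

lemma abelian_monoid_quotient_module: "abelian_monoid M"
  by (rule abelian_monoidI)
    (auto simp: carrier_quotient_module zero_quotient_module add_quotient_module polys_add algebra_simps)

lemma finsum_quotient_module:
  assumes "finite A" "\<And>i. i \<in> A \<Longrightarrow> f i \<in> polys {1..n}"
  shows "(\<Oplus>\<^bsub>M\<^esub>i\<in>A. residue n I (f i)) = residue n I (\<Sum>i\<in>A. f i)"
proof -
  interpret M: abelian_monoid M by (rule abelian_monoid_quotient_module)
  show ?thesis using assms
    by (induction A rule: finite_induct)
      (simp_all add: zero_quotient_module M.finsum_insert Pi_def carrier_quotient_module
        add_quotient_module polys_sum)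
qed

lemma stanley_space_residue:
  assumes "Z \<subseteq> {1..n}" "q \<in> polys {1..n}"
  shows "stanley_space M (residue n I q) Z = residue n I ` {u * q | u. u \<in> polys Z}"
proof -
  have "u \<odot>\<^bsub>M\<^esub> residue n I q = residue n I (u * q)" if "u \<in> polys Z" for u
    using that assms polys_mono[of Z "{1..n}"] by (intro smult_quotient_module) auto
  then show ?thesis by (force simp: stanley_space_def)
qed

end

section \<open>Interval partitions\<close>

text \<open>The number \<open>d\<close> bounds the tops \<open>B\<close> from below; their sizes
  become the numbers \<open>|Z|\<close> of a Stanley decomposition. The last clause makes the
  intervals of distinct pairs disjoint.\<close>

definition interval_partition :: "(nat set \<times> nat set) set \<Rightarrow> nat \<Rightarrow> nat set set \<Rightarrow> bool" where
  "interval_partition P d \<Delta> \<longleftrightarrow>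
     finite P \<and> (\<forall>(A, B)\<in>P. A \<subseteq> B \<and> finite B \<and> d \<le> card B) \<and>
     (\<forall>F. F \<in> \<Delta> \<longleftrightarrow> (\<exists>X\<in>P. F \<in> {fst X..snd X})) \<and>
     (\<forall>X\<in>P. \<forall>Y\<in>P. \<forall>F. F \<in> {fst X..snd X} \<longrightarrow> F \<in> {fst Y..snd Y} \<longrightarrow> X = Y)"

lemma interval_partitionI:
  assumes "finite P" "\<And>X. X \<in> P \<Longrightarrow> fst X \<subseteq> snd X \<and> finite (snd X) \<and> d \<le> card (snd X)"
    and "\<And>F. F \<in> \<Delta> \<longleftrightarrow> (\<exists>X\<in>P. F \<in> {fst X..snd X})"
    and "\<And>X Y F. X \<in> P \<Longrightarrow> Y \<in> P \<Longrightarrow> F \<in> {fst X..snd X} \<Longrightarrow> F \<in> {fst Y..snd Y} \<Longrightarrow> X = Y"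
  shows "interval_partition P d \<Delta>"
  unfolding interval_partition_def
proof (intro conjI ballI allI impI)
  show "case X of (A, B) \<Rightarrow> A \<subseteq> B \<and> finite B \<and> d \<le> card B" if "X \<in> P" for X
    using assms(2)[OF that] by (simp add: case_prod_beta)
qed (use assms(1,3,4) in simp_all)

lemma interval_partition_covers:
  "interval_partition P d \<Delta> \<Longrightarrow> F \<in> \<Delta> \<longleftrightarrow> (\<exists>X\<in>P. F \<in> {fst X..snd X})"
  unfolding interval_partition_def by meson

lemma interval_partition_unique:
  "interval_partition P d \<Delta> \<Longrightarrow> X \<in> P \<Longrightarrow> Y \<in> P \<Longrightarrow>
    F \<in> {fst X..snd X} \<Longrightarrow> F \<in> {fst Y..snd Y} \<Longrightarrow> X = Y"
  unfolding interval_partition_def by meson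

lemma interval_partition_mem:
  assumes "interval_partition P d \<Delta>" "X \<in> P"
  shows "fst X \<subseteq> snd X" "snd X \<in> \<Delta>" "finite (snd X)" "d \<le> card (snd X)"
proof -
  have "case X of (A, B) \<Rightarrow> A \<subseteq> B \<and> finite B \<and> d \<le> card B"
    using assms unfolding interval_partition_def by meson
  then show *: "fst X \<subseteq> snd X" "finite (snd X)" "d \<le> card (snd X)" by (auto simp: case_prod_beta)
  show "snd X \<in> \<Delta>"
    using * assms(2) by (intro interval_partition_covers[OF assms(1), THEN iffD2] bexI) auto
qed

lemma interval_partition_finite: "interval_partition P d \<Delta> \<Longrightarrow> finite P"
  by (simp add: interval_partition_def)

section \<open>Operations on interval partitions\<close>

lemma interval_partition_mono:
  assumes "interval_partition P d \<Delta>" "d' \<le> d" shows "interval_partition P d' \<Delta>"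
proof (rule interval_partitionI)
  show "fst X \<subseteq> snd X \<and> finite (snd X) \<and> d' \<le> card (snd X)" if "X \<in> P" for X
    using interval_partition_mem[OF assms(1) that] assms(2) by simp
qed (fact interval_partition_finite[OF assms(1)] interval_partition_covers[OF assms(1)]
  interval_partition_unique[OF assms(1)])+

text \<open>Every interval stays inside its own family, so two intervals with a common member come
  from the same partition.\<close>

lemma interval_partition_Un:
  assumes P: "interval_partition P d \<Delta>" and P': "interval_partition P' d \<Delta>'" and "\<Delta> \<inter> \<Delta>' = {}"
  shows "interval_partition (P \<union> P') d (\<Delta> \<union> \<Delta>')"
proof (rule interval_partitionI)
  show "X = Y" if "X \<in> P \<union> P'" "Y \<in> P \<union> P'" and F: "F \<in> {fst X..snd X}" "F \<in> {fst Y..snd Y}" for X Y F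
  proof -
    have "X \<in> P \<and> Y \<in> P \<or> X \<in> P' \<and> Y \<in> P'"
      using interval_partition_covers[OF P, of F] interval_partition_covers[OF P', of F] that assms(3)
      by (metis Un_iff disjoint_iff)
    then show ?thesis
      using interval_partition_unique[OF P _ _ F] interval_partition_unique[OF P' _ _ F] by metis
  qed
  show "F \<in> \<Delta> \<union> \<Delta>' \<longleftrightarrow> (\<exists>X\<in>P \<union> P'. F \<in> {fst X..snd X})" for F
    using interval_partition_covers[OF P, of F] interval_partition_covers[OF P', of F] by (metis Un_iff)
  show "finite (P \<union> P')" using P P' by (simp add: interval_partition_finite)
  show "fst X \<subseteq> snd X \<and> finite (snd X) \<and> d \<le> card (snd X)" if "X \<in> P \<union> P'" for X
    using that interval_partition_mem[OF P, of X] interval_partition_mem[OF P', of X] by (metis Un_iff)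
qed

text \<open>Covering and disjointness only speak about membership, so they survive pulling back
  along \<open>r\<close> and restricting to \<open>Q\<close>; \<open>g\<close> supplies the
  endpoints of the pulled-back intervals. The next two constructions are instances.\<close>

lemma interval_partition_vimage:
  assumes P: "interval_partition P d \<Delta>"
    and mem: "\<And>X F. X \<in> P \<Longrightarrow> F \<in> {fst (g X)..snd (g X)} \<longleftrightarrow> r F \<in> {fst X..snd X} \<and> Q F"
    and size: "\<And>X. X \<in> P \<Longrightarrow> fst (g X) \<subseteq> snd (g X) \<and> finite (snd (g X)) \<and> d' \<le> card (snd (g X))"
    and \<Delta>': "\<And>F. F \<in> \<Delta>' \<longleftrightarrow> r F \<in> \<Delta> \<and> Q F"
  shows "interval_partition (g ` P) d' \<Delta>'"
proof (rule interval_partitionI)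
  show "F \<in> \<Delta>' \<longleftrightarrow> (\<exists>X\<in>g ` P. F \<in> {fst X..snd X})" for F
  proof -
    have "(\<exists>X\<in>g ` P. F \<in> {fst X..snd X}) \<longleftrightarrow> (\<exists>X\<in>P. r F \<in> {fst X..snd X}) \<and> Q F"
      using mem[of _ F] by (simp only: bex_simps) meson
    then show ?thesis by (simp only: \<Delta>' interval_partition_covers[OF P])
  qed
  show "X' = Y'" if X': "X' \<in> g ` P" and Y': "Y' \<in> g ` P" and "F \<in> {fst X'..snd X'}" "F \<in> {fst Y'..snd Y'}"
    for X' Y' F
  proof -
    obtain X Y where XY: "X \<in> P" "Y \<in> P" "X' = g X" "Y' = g Y" using X' Y' by blast
    have "X = Y"
      by (rule interval_partition_unique[OF P XY(1,2), of "r F"])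
        (use that(3,4) mem[OF XY(1), of F] mem[OF XY(2), of F] in \<open>simp_all only: XY\<close>)
    with XY show ?thesis by simp
  qed
  show "finite (g ` P)" using P by (simp add: interval_partition_finite)
  show "fst X \<subseteq> snd X \<and> finite (snd X) \<and> d' \<le> card (snd X)" if "X \<in> g ` P" for X
    using that size by auto
qed

text \<open>On sets containing \<open>v\<close>, deleting \<open>v\<close> inverts inserting it, so
  both endpoints of each interval simply gain \<open>v\<close>.\<close>

lemma interval_partition_insert:
  assumes P: "interval_partition P d \<Delta>" and v: "\<And>F. F \<in> \<Delta> \<Longrightarrow> v \<notin> F"
  shows "interval_partition ((\<lambda>(A, B). (insert v A, insert v B)) ` P) (Suc d) (insert v ` \<Delta>)"
  using P
proof (rule interval_partition_vimage[where r = "\<lambda>F. F - {v}" and Q = "\<lambda>F. v \<in> F"])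
  fix X assume "X \<in> P"
  note X = interval_partition_mem[OF P this]
  with v have notin: "v \<notin> fst X" "v \<notin> snd X" by blast+
  show "F \<in> {fst (case X of (A, B) \<Rightarrow> (insert v A, insert v B))..snd (case X of (A, B) \<Rightarrow> (insert v A, insert v B))}
      \<longleftrightarrow> F - {v} \<in> {fst X..snd X} \<and> v \<in> F" for F
    using notin by (auto simp: case_prod_beta)
  show "fst (case X of (A, B) \<Rightarrow> (insert v A, insert v B)) \<subseteq> snd (case X of (A, B) \<Rightarrow> (insert v A, insert v B)) \<and>
      finite (snd (case X of (A, B) \<Rightarrow> (insert v A, insert v B))) \<and>
      Suc d \<le> card (snd (case X of (A, B) \<Rightarrow> (insert v A, insert v B)))"
    using notin X by (auto simp: case_prod_beta)
next
  fix F
  have "F \<in> insert v ` \<Delta>" if "F - {v} \<in> \<Delta>" "v \<in> F"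
    using that by (intro image_eqI[of _ _ "F - {v}"]) auto
  with v show "F \<in> insert v ` \<Delta> \<longleftrightarrow> F - {v} \<in> \<Delta> \<and> v \<in> F" by auto
qed

text \<open>The family is the cone over \<open>\<Delta>\<close> with apex \<open>v\<close>: whether
  \<open>v\<close> is present is free, so only the top of each interval gains
  \<open>v\<close>.\<close>

lemma interval_partition_cone:
  assumes P: "interval_partition P d \<Delta>" and v: "\<And>F. F \<in> \<Delta> \<Longrightarrow> v \<notin> F"
  shows "interval_partition ((\<lambda>(A, B). (A, insert v B)) ` P) (Suc d) (\<Delta> \<union> insert v ` \<Delta>)"
  using P
proof (rule interval_partition_vimage[where r = "\<lambda>F. F - {v}" and Q = "\<lambda>F. True"])
  fix X assume "X \<in> P"
  note X = interval_partition_mem[OF P this]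
  with v have notin: "v \<notin> fst X" "v \<notin> snd X" by blast+
  show "F \<in> {fst (case X of (A, B) \<Rightarrow> (A, insert v B))..snd (case X of (A, B) \<Rightarrow> (A, insert v B))}
      \<longleftrightarrow> F - {v} \<in> {fst X..snd X} \<and> True" for F
    using notin by (auto simp: case_prod_beta)
  show "fst (case X of (A, B) \<Rightarrow> (A, insert v B)) \<subseteq> snd (case X of (A, B) \<Rightarrow> (A, insert v B)) \<and>
      finite (snd (case X of (A, B) \<Rightarrow> (A, insert v B))) \<and>
      Suc d \<le> card (snd (case X of (A, B) \<Rightarrow> (A, insert v B)))"
    using notin X by (auto simp: case_prod_beta)
next
  fix F
  have "F \<in> \<Delta> \<union> insert v ` \<Delta>" if "F - {v} \<in> \<Delta>"
  proof (cases "v \<in> F")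
    case True
    then have "F = insert v (F - {v})" by auto
    with that show ?thesis by blast
  qed (use that in auto)
  with v show "F \<in> \<Delta> \<union> insert v ` \<Delta> \<longleftrightarrow> F - {v} \<in> \<Delta> \<and> True" by auto
qed

section \<open>Independent sets of paths and cycles\<close>

text \<open>Independent sets of the path on the \<open>m\<close> consecutive vertices from
  \<open>a\<close> on. The start is variable because the cycle reduces to paths starting at 1 and at
  2.\<close>

definition path_faces :: "nat \<Rightarrow> nat \<Rightarrow> nat set set" where
  "path_faces a m = {F. F \<subseteq> {a..<a + m} \<and> (\<forall>i\<in>F. Suc i \<notin> F)}"

definition cycle_faces :: "nat \<Rightarrow> nat set set" where
  "cycle_faces n = {F. F \<subseteq> {1..n} \<and> (\<forall>i\<in>F. Suc i \<notin> F) \<and> \<not> (n \<in> F \<and> 1 \<in> F)}"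

text \<open>The vertex \<open>a + m + 1\<close> blocks both neighbours \<open>a + m\<close> and
  \<open>a + m + 2\<close>. If it is absent, \<open>a + m + 2\<close> has no neighbour left and
  becomes the apex of a cone.\<close>

lemma path_faces_rec:
  "path_faces a (m + 3) = insert (a + m + 1) ` path_faces a m \<union>
     (path_faces a (m + 1) \<union> insert (a + m + 2) ` path_faces a (m + 1))" (is "?L = ?M \<union> (?N \<union> ?R)")
proof (intro Set.equalityI subsetI)
  fix F assume F: "F \<in> path_faces a (m + 3)"
  then have ins: "F = insert x (F - {x})" if "x \<in> F" for x using that by auto
  consider "a + m + 1 \<in> F" | "a + m + 1 \<notin> F" "a + m + 2 \<notin> F" | "a + m + 1 \<notin> F" "a + m + 2 \<in> F"
    by blast
  then show "F \<in> ?M \<union> (?N \<union> ?R)"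
  proof cases
    case 1
    have "F - {a + m + 1} \<in> path_faces a m"
      unfolding path_faces_def
    proof (intro CollectI conjI subsetI ballI)
      fix i assume i: "i \<in> F - {a + m + 1}"
      then have "i \<in> {a..<a + (m + 3)}" "i \<noteq> a + m" "i \<noteq> a + m + 2"
        using F 1 by (auto simp: path_faces_def)
      with i show "i \<in> {a..<a + m}" by auto
    qed (use F in \<open>auto simp: path_faces_def\<close>)
    with ins[OF 1] show ?thesis by blast
  next
    case 2
    have "F \<in> ?N"
      unfolding path_faces_def
    proof (intro CollectI conjI subsetI ballI)
      fix i assume i: "i \<in> F"
      then have "i \<in> {a..<a + (m + 3)}" "i \<noteq> a + m + 1" "i \<noteq> a + m + 2"
        using F 2 by (auto simp: path_faces_def)
      then show "i \<in> {a..<a + (m + 1)}" by auto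
    qed (use F in \<open>auto simp: path_faces_def\<close>)
    then show ?thesis by blast
  next
    case 3
    have "F - {a + m + 2} \<in> path_faces a (m + 1)"
      unfolding path_faces_def
    proof (intro CollectI conjI subsetI ballI)
      fix i assume i: "i \<in> F - {a + m + 2}"
      then have "i \<in> {a..<a + (m + 3)}" "i \<noteq> a + m + 1" "i \<noteq> a + m + 2"
        using F 3 by (auto simp: path_faces_def)
      then show "i \<in> {a..<a + (m + 1)}" by auto
    qed (use F in \<open>auto simp: path_faces_def\<close>)
    with ins[OF 3(2)] show ?thesis by blast
  qed
qed (force simp: path_faces_def)+

lemma path_faces_notin: "F \<in> path_faces a m \<Longrightarrow> a + m \<le> v \<Longrightarrow> v \<notin> F"
  by (auto simp: path_faces_def)

text \<open>The bound is the ceiling of \<open>m/3\<close>. The recursion shortens the path by three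
  or by two vertices, and either way each top gains one.\<close>

lemma ex_interval_partition_path: "\<exists>P. interval_partition P ((m + 2) div 3) (path_faces a m)"
proof (induction m rule: less_induct)
  case (less m)
  have empty: "interval_partition {({}, {})} 0 {{}}"
    by (rule interval_partitionI) auto
  \<comment> \<open>With truncated subtraction the last alternative says
    \<open>m \<ge> 3\<close>.\<close>
  have "m = 0 \<or> m = 1 \<or> m = 2 \<or> m = (m - 3) + 3" by linarith
  then consider "m = 0" | "m = 1" | "m = 2" | k where "m = k + 3" by blast
  then show ?case
  proof cases
    case 1
    then have "path_faces a m = {{}}" by (auto simp: path_faces_def)
    with 1 empty show ?thesis by auto
  next
    case 2
    then have "path_faces a m = {{}} \<union> insert a ` {{}}"
      by (auto simp: path_faces_def subset_singleton_iff)
    with 2 interval_partition_cone[OF empty, of a] show ?thesis by auto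
  next
    case 3
    \<comment> \<open>The partition consists of the interval from \<open>{}\<close> to
      \<open>{a}\<close> and the single face \<open>{Suc a}\<close>; both tops have one
      element.\<close>
    have "path_faces a m = ({{}} \<union> insert a ` {{}}) \<union> insert (Suc a) ` {{}}"
    proof (intro Set.equalityI subsetI)
      fix F assume F: "F \<in> path_faces a m"
      moreover have "{a..<a + m} = {a, Suc a}" using 3 by auto
      ultimately have "F \<subseteq> {a, Suc a}" "a \<notin> F \<or> Suc a \<notin> F" by (auto simp: path_faces_def)
      then have "F = {} \<or> F = {a} \<or> F = {Suc a}" by blast
      then show "F \<in> ({{}} \<union> insert a ` {{}}) \<union> insert (Suc a) ` {{}}" by auto
    qed (use 3 in \<open>auto simp: path_faces_def\<close>)
    with 3 interval_partition_Un[OF interval_partition_cone[OF empty, of a]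
        interval_partition_insert[OF empty, of "Suc a"]]
    show ?thesis by auto
  next
    case (4 k)
    obtain P where "interval_partition P ((k + 2) div 3) (path_faces a k)"
      using less[of k] 4 by auto
    from interval_partition_insert[OF this, of "a + k + 1"] path_faces_notin[of _ a k "a + k + 1"]
    obtain P where "interval_partition P (Suc ((k + 2) div 3)) (insert (a + k + 1) ` path_faces a k)"
      by auto
    \<comment> \<open>Equality holds here, so this piece determines the bound.\<close>
    moreover have "(m + 2) div 3 \<le> Suc ((k + 2) div 3)" using 4 by simp
    ultimately have P: "interval_partition P ((m + 2) div 3) (insert (a + k + 1) ` path_faces a k)"
      by (rule interval_partition_mono)
    obtain P' where "interval_partition P' ((k + 3) div 3) (path_faces a (k + 1))"
      using less[of "k + 1"] 4 by auto
    from interval_partition_cone[OF this, of "a + k + 2"] path_faces_notin[of _ a "k + 1" "a + k + 2"]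
    obtain P' where "interval_partition P' (Suc ((k + 3) div 3))
        (path_faces a (k + 1) \<union> insert (a + k + 2) ` path_faces a (k + 1))"
      by auto
    moreover have "(m + 2) div 3 \<le> Suc ((k + 3) div 3)" using 4 by simp
    ultimately have P': "interval_partition P' ((m + 2) div 3)
        (path_faces a (k + 1) \<union> insert (a + k + 2) ` path_faces a (k + 1))"
      by (rule interval_partition_mono)
    have "a + k + 1 \<notin> F" if "F \<in> path_faces a (k + 1) \<union> insert (a + k + 2) ` path_faces a (k + 1)" for F
      using that path_faces_notin[of _ a "k + 1" "a + k + 1"] by auto
    then have "insert (a + k + 1) ` path_faces a k \<inter>
        (path_faces a (k + 1) \<union> insert (a + k + 2) ` path_faces a (k + 1)) = {}" by blast
    from interval_partition_Un[OF P P' this] have "interval_partition (P \<union> P') ((m + 2) div 3) (path_faces a m)"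
      unfolding 4 path_faces_rec .
    then show ?thesis by blast
  qed
qed

text \<open>Without \<open>n\<close> the cycle opens to the path from 1 to \<open>n - 1\<close>;
  with \<open>n\<close> both 1 and \<open>n - 1\<close> are blocked, leaving the path from 2 to
  \<open>n - 2\<close>, which is empty for \<open>n = 3\<close>.\<close>

lemma cycle_faces_rec:
  assumes "n \<ge> 3"
  shows "cycle_faces n = path_faces 1 (n - 1) \<union> insert n ` path_faces 2 (n - 3)"
proof (intro Set.equalityI subsetI)
  fix F assume F: "F \<in> cycle_faces n"
  show "F \<in> path_faces 1 (n - 1) \<union> insert n ` path_faces 2 (n - 3)"
  proof (cases "n \<in> F")
    case True
    have "F - {n} \<in> path_faces 2 (n - 3)"
      unfolding path_faces_def
    proof (intro CollectI conjI subsetI ballI)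
      fix i assume i: "i \<in> F - {n}"
      then have "Suc i \<noteq> n" using True F by (auto simp: cycle_faces_def)
      moreover have "i \<noteq> 1" "i \<in> {1..n}" "i \<noteq> n" using i True F by (auto simp: cycle_faces_def)
      ultimately show "i \<in> {2..<2 + (n - 3)}" using assms by auto
    qed (use F in \<open>auto simp: cycle_faces_def\<close>)
    moreover have "F = insert n (F - {n})" using True by auto
    ultimately show ?thesis by blast
  next
    case False
    have "F \<in> path_faces 1 (n - 1)"
      unfolding path_faces_def
    proof (intro CollectI conjI subsetI ballI)
      fix i assume i: "i \<in> F"
      then have "i \<in> {1..n}" "i \<noteq> n" using False F by (auto simp: cycle_faces_def)
      then show "i \<in> {1..<1 + (n - 1)}" by auto
    qed (use F in \<open>auto simp: cycle_faces_def\<close>)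
    then show ?thesis by blast
  qed
next
  fix F assume "F \<in> path_faces 1 (n - 1) \<union> insert n ` path_faces 2 (n - 3)"
  then show "F \<in> cycle_faces n"
    using assms by (fastforce simp: path_faces_def cycle_faces_def subset_iff)
qed

text \<open>The path on \<open>n - 1\<close> vertices gives \<open>(n + 1) div 3\<close>, the
  ceiling of \<open>(n - 1)/3\<close>. The other piece gives \<open>(n + 2) div 3\<close> thanks to
  the added vertex \<open>n\<close>.\<close>

lemma ex_interval_partition_cycle:
  assumes "n \<ge> 3"
  shows "\<exists>P. interval_partition P ((n + 1) div 3) (cycle_faces n)"
proof -
  obtain P where P: "interval_partition P ((n + 1) div 3) (path_faces 1 (n - 1))"
    using ex_interval_partition_path[of "n - 1" 1] assms by auto
  obtain P' where "interval_partition P' ((n - 3 + 2) div 3) (path_faces 2 (n - 3))"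
    using ex_interval_partition_path by blast
  note interval_partition_insert[OF this path_faces_notin[of _ 2 "n - 3"], where v = n]
  then obtain P' where "interval_partition P' (Suc ((n - 3 + 2) div 3)) (insert n ` path_faces 2 (n - 3))"
    using assms by fastforce
  then have P': "interval_partition P' ((n + 1) div 3) (insert n ` path_faces 2 (n - 3))"
    by (rule interval_partition_mono) (use assms in simp)
  have "interval_partition (P \<union> P') ((n + 1) div 3) (cycle_faces n)"
    unfolding cycle_faces_rec[OF assms]
  proof (rule interval_partition_Un[OF P P'])
    show "path_faces 1 (n - 1) \<inter> insert n ` path_faces 2 (n - 3) = {}"
      using assms by (auto simp: path_faces_def)
  qed
  then show ?thesis by blast
qed

text \<open>Every third vertex \<open>1, 4, 7, ...\<close> is taken, and \<open>n - 1\<close> is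
  added if 3 does not divide \<open>n\<close>. Each remaining vertex then has a neighbour in the
  set, which gives maximality.\<close>

lemma ex_cycle_facet:
  assumes "n \<ge> 3"
  shows "\<exists>F\<in>cycle_faces n. card F = (n + 2) div 3 \<and> (\<forall>G\<in>cycle_faces n. F \<subseteq> G \<longrightarrow> G = F)"
proof -
  obtain k r where n: "n = 3 * k + r" and r: "r < 3"
    using that[of "n div 3" "n mod 3"] by simp
  have k: "k > 0" using assms n r by simp
  define T where "T = (\<lambda>j. 3 * j + 1) ` {..<k}"
  \<comment> \<open>The extra vertex is \<open>n - 1\<close>, not \<open>n\<close>, since
    \<open>n\<close> is adjacent to 1.\<close>
  define F where "F = (if r = 0 then T else insert (3 * k + r - 1) T)"
  have TF: "3 * j + 1 \<in> F" if "j < k" for j using that by (auto simp: F_def T_def)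
  have lF: "3 * k + r - 1 \<in> F" if "r \<noteq> 0" using that by (auto simp: F_def)
  have F: "(\<exists>j<k. i = 3 * j + 1) \<or> r \<noteq> 0 \<and> i = 3 * k + r - 1" if "i \<in> F" for i
    using that by (auto simp: F_def T_def split: if_splits)
  have "card T = k" unfolding T_def by (subst card_image) (auto simp: inj_on_def)
  moreover have "3 * k + r - 1 \<notin> T" if "r \<noteq> 0" using that by (auto simp: T_def)
  moreover have "finite T" by (simp add: T_def)
  ultimately have "card F = (if r = 0 then k else Suc k)" by (auto simp: F_def)
  also have "\<dots> = (n + 2) div 3"
  proof -
    consider "r = 0" | "r = 1" | "r = 2" using r by linarith
    then show ?thesis using n by cases simp_all
  qed
  finally have card: "card F = (n + 2) div 3" .
  have le: "1 \<le> i \<and> i < n" if "i \<in> F" for i using F[OF that] n k by auto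
  have ind: "Suc i \<notin> F" if "i \<in> F" for i
  proof
    assume "Suc i \<in> F"
    from F[OF this] F[OF that] r show False by (elim disjE exE conjE) presburger+
  qed
  have cyc: "F \<in> cycle_faces n" using le ind by (force simp: cycle_faces_def)
  have max: "G = F" if G: "G \<in> cycle_faces n" "F \<subseteq> G" for G
  proof (rule ccontr)
    assume "G \<noteq> F"
    then obtain i where i: "i \<in> G" "i \<notin> F" using G by auto
    have iN: "1 \<le> i" "i \<le> n" using G(1) i(1) by (auto simp: cycle_faces_def)
    have "1 \<in> F" using TF[of 0] k by simp
    \<comment> \<open>In each alternative \<open>i\<close> has a neighbour in \<open>F\<close>; for
      \<open>i = n\<close> it is the vertex 1. As \<open>F \<subseteq> G\<close>, this contradicts
      independence of \<open>G\<close>.\<close>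
    moreover have "Suc i \<in> F \<or> (\<exists>j\<in>F. i = Suc j) \<or> i = n"
    proof -
      obtain q s where qs: "i = 3 * q + s" and s: "s < 3"
        using that[of "i div 3" "i mod 3"] by simp
      \<comment> \<open>For \<open>q < k\<close> the vertex \<open>3 * q + 1\<close> of
        \<open>F\<close> is \<open>i\<close> itself or adjacent to it. The cases
        \<open>q = k\<close> treat the at most three vertices from \<open>3 * k\<close> on.\<close>
      consider "s = 0" "q < k" | "s = 0" "q = k" | "s = 1" "q < k" | "s = 1" "q = k"
        | "s = 2" "q < k" | "s = 2" "q = k"
        using qs s iN(2) n r by linarith
      then show ?thesis
      proof cases
        case 1 then show ?thesis using TF[of q] qs by auto
      next
        case 2
        consider "r = 0" | "r = 1" | "r = 2" using r by linarith
        then show ?thesis using lF i(2) 2 qs n by cases auto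
      next
        case 3 then show ?thesis using TF[of q] qs i(2) by auto
      next
        case 4
        consider "r = 0" | "r = 1" | "r = 2" using r by linarith
        then show ?thesis using lF i(2) iN(2) 4 qs n by cases auto
      next
        case 5 then show ?thesis using TF[of q] qs by auto
      next
        case 6
        then show ?thesis using iN(2) qs n r by auto
      qed
    qed
    ultimately show False using G i(1) by (auto simp: cycle_faces_def)
  qed
  show ?thesis using cyc card max by blast
qed

section \<open>Stanley--Reisner rings\<close>

locale simplicial_complex =
  fixes n :: nat and \<Delta> :: "nat set set"
  assumes face_subset: "F \<in> \<Delta> \<Longrightarrow> F \<subseteq> {1..n}"
    and subset_face: "F \<in> \<Delta> \<Longrightarrow> G \<subseteq> F \<Longrightarrow> G \<in> \<Delta>"
    and empty_face: "{} \<in> \<Delta>"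
begin

lemma face_finite: "F \<in> \<Delta> \<Longrightarrow> finite F"
  by (rule finite_subset[OF face_subset]) auto

text \<open>The Stanley-Reisner ideal of \<open>\<Delta>\<close>, described as the span of its
  monomials rather than by generators, so that membership can be read off from supports.\<close>

definition nonface_ideal :: "'k::comm_ring_1 mpol set" where
  "nonface_ideal = {p \<in> polys {1..n}. \<forall>e\<in>keys p. keys e \<notin> \<Delta>}"

lemma lookup_nonface_ideal: "p \<in> nonface_ideal \<Longrightarrow> keys e \<in> \<Delta> \<Longrightarrow> lookup p e = 0"
  by (auto simp: nonface_ideal_def in_keys_iff)

text \<open>Multiplying monomials unites supports, and a superset of a nonface is a nonface.\<close>

lemma ideal_nonface_ideal: "ideal (nonface_ideal :: 'k::comm_ring_1 mpol set) (poly_ring n)"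
proof -
  interpret cring "poly_ring n :: 'k mpol ring" by (rule cring_poly_ring)
  have uminus: "\<ominus>\<^bsub>poly_ring n\<^esub> p = - p" if "p \<in> polys {1..n}" for p :: "'k mpol"
    using that by (intro minus_equality) (auto simp: poly_ring_def polys_uminus)
  have mult: "x * a \<in> nonface_ideal" if "a \<in> nonface_ideal" "x \<in> polys {1..n}" for a x :: "'k mpol"
  proof -
    have "keys e \<notin> \<Delta>" if e: "e \<in> keys (x * a)" for e
    proof -
      obtain e1 e2 where "e = e1 + e2" "e1 \<in> keys x" "e2 \<in> keys a"
        using keys_mult[of x a] e by blast
      then show ?thesis using \<open>a \<in> nonface_ideal\<close> subset_face[of "keys e" "keys e2"]
        by (auto simp: nonface_ideal_def keys_plus_nat)
    qed
    then show ?thesis using that by (auto simp: nonface_ideal_def polys_mult)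
  qed
  show ?thesis
  proof (rule idealI)
    show "subgroup nonface_ideal (add_monoid (poly_ring n :: 'k mpol ring))"
    proof (rule add.subgroupI)
      show "(nonface_ideal :: 'k mpol set) \<subseteq> carrier (poly_ring n)"
        by (auto simp: nonface_ideal_def poly_ring_def)
      have "(0 :: 'k mpol) \<in> nonface_ideal" by (auto simp: nonface_ideal_def)
      then show "(nonface_ideal :: 'k mpol set) \<noteq> {}" by blast
      show "\<ominus>\<^bsub>poly_ring n\<^esub> a \<in> nonface_ideal" if "a \<in> nonface_ideal" for a :: "'k mpol"
        using that uminus[of a] by (auto simp: nonface_ideal_def polys_uminus in_keys_iff)
      show "a \<oplus>\<^bsub>poly_ring n\<^esub> b \<in> nonface_ideal" if "a \<in> nonface_ideal" "b \<in> nonface_ideal"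
        for a b :: "'k mpol"
        using that keys_add[of a b] by (auto simp: nonface_ideal_def poly_ring_def polys_add)
    qed
    show "ring (poly_ring n :: 'k mpol ring)" by (rule ring_axioms)
    fix a x :: "'k mpol"
    assume "a \<in> nonface_ideal" "x \<in> carrier (poly_ring n)"
    then have "x * a \<in> nonface_ideal" by (intro mult) (simp_all add: poly_ring_def)
    then show "x \<otimes>\<^bsub>poly_ring n\<^esub> a \<in> nonface_ideal" "a \<otimes>\<^bsub>poly_ring n\<^esub> x \<in> nonface_ideal"
      by (simp_all add: poly_ring_def mult.commute)
  qed
qed

abbreviation face_ring :: "('k::comm_ring_1 mpol, 'k mpol set) module" where
  "face_ring \<equiv> quotient_module (poly_ring n) nonface_ideal"

section \<open>Stanley decompositions from interval partitions\<close>

lemma stanley_space_interval: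
  assumes "A \<subseteq> B" "B \<in> \<Delta>"
  shows "stanley_space face_ring (residue n nonface_ideal (monom (set_exp A))) B =
    residue n nonface_ideal ` {q :: 'k::comm_ring_1 mpol. \<forall>e\<in>keys q. keys e \<in> {A..B}}"
proof -
  have B: "B \<subseteq> {1..n}" by (rule face_subset[OF assms(2)])
  have fin: "finite B" "finite A"
    using assms face_finite[OF assms(2)] face_finite[OF subset_face[OF assms(2,1)]] by auto
  then have "monom (set_exp A) \<in> (polys {1..n} :: 'k mpol set)" using B assms(1) by (intro polys_single) auto
  then show ?thesis
    by (simp only: stanley_space_residue[OF ideal_nonface_ideal B] multiples_set_exp_eq[OF assms(1) fin(1)])
qed

text \<open>The support of each basis monomial lies in exactly one interval, so the spaces
  \<open>x^A K[B]\<close> split the basis of \<open>S/I\<close> among themselves. The list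
  \<open>L\<close> is distinct so that an interval determines its index.\<close>

lemma stanley_decomposition_interval_partition:
  assumes "interval_partition P d \<Delta>" "set L = P" "distinct L"
  shows "stanley_decomposition n (face_ring :: ('k::comm_ring_1 mpol, _) module)
    (quotient_component n nonface_ideal)
    (map (\<lambda>(A, B). (residue n nonface_ideal (monom (set_exp A)), B)) L)"
    (is "stanley_decomposition n ?M _ ?D")
proof -
  let ?r = "residue n nonface_ideal :: 'k mpol \<Rightarrow> _"
  note I = ideal_nonface_ideal[where 'k = 'k]
  define A where "A j = fst (L ! j)" for j
  define B where "B j = snd (L ! j)" for j
  \<comment> \<open>Polynomials representing the elements of the \<open>j\<close>-th Stanley
    space.\<close>
  define R :: "nat \<Rightarrow> 'k mpol set" where "R j = {q. \<forall>e\<in>keys q. keys e \<in> {A j..B j}}" for j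
  have AB: "A \<subseteq> B" "B \<in> \<Delta>" "B \<subseteq> {1..n}" if "(A, B) \<in> P" for A B
    using interval_partition_mem(1,2)[OF assms(1) that] face_subset[of B] by simp_all
  have mem: "(A j, B j) \<in> P" if "j < length L" for j
    using that assms(2) by (auto simp: A_def B_def)
  have RI: "R j \<subseteq> polys {1..n}" if "j < length L" for j
    using AB(3)[OF mem[OF that]] by (auto simp: R_def polys_def)
  have face: "\<exists>j<length L. F \<in> {A j..B j}" if F: "F \<in> \<Delta>" for F
  proof -
    obtain X where X: "X \<in> P" "F \<in> {fst X..snd X}"
      using F interval_partition_covers[OF assms(1), of F] by blast
    then obtain j where "j < length L" "L ! j = X" using assms(2) by (auto simp: in_set_conv_nth)
    with X show ?thesis by (auto simp: A_def B_def)
  qed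
  have unique: "i = j" if "i < length L" "j < length L" "F \<in> {A i..B i}" "F \<in> {A j..B j}" for F i j
  proof -
    have "L ! i = L ! j"
      using that assms(2) by (intro interval_partition_unique[OF assms(1), of _ _ F]) (auto simp: A_def B_def)
    then show ?thesis using assms(3) that by (simp add: nth_eq_iff_index_eq)
  qed
  have space: "stanley_space ?M (fst (?D ! j)) (snd (?D ! j)) = ?r ` R j" if "j < length L" for j
    using stanley_space_interval[where 'k = 'k, OF AB(1,2)[OF mem[OF that]]] that
    by (simp add: A_def B_def R_def case_prod_beta)
  have PiE_space: "(\<Pi>\<^sub>E i\<in>{..<length ?D}. stanley_space ?M (fst (?D ! i)) (snd (?D ! i))) =
      (\<Pi>\<^sub>E i\<in>{..<length L}. ?r ` R i)"
    unfolding length_map by (rule PiE_cong) (rule space, simp)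
  have gens: "m \<in> carrier ?M \<and> homogeneous n (quotient_component n nonface_ideal) m \<and>
      Z \<subseteq> {1..n} \<and> (\<forall>u\<in>polys Z. u \<odot>\<^bsub>?M\<^esub> m = \<zero>\<^bsub>?M\<^esub> \<longrightarrow> u = 0)" if "(m, Z) \<in> set ?D" for m Z
  proof -
    from that obtain X where X: "(X, Z) \<in> P" and m: "m = ?r (monom (set_exp X))"
      using assms(2) by auto
    note Z = AB[OF X]
    have fin: "finite Z" "finite X"
      using face_finite[OF Z(2)] face_finite[OF subset_face[OF Z(2,1)]] by auto
    have poly: "(monom (set_exp X) :: 'k mpol) \<in> polys {1..n}"
      using Z fin by (intro polys_single) auto
    have "monom (set_exp X) \<in> (poly_component n (\<lambda>i. int (lookup (set_exp X) i)) :: 'k mpol set)"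
      using poly by (auto simp: poly_component_def)
    moreover have "(\<lambda>i. int (lookup (set_exp X) i)) \<in> Zn n"
      using Z fin by (auto simp: Zn_def lookup_set_exp when_def subset_iff)
    ultimately have "homogeneous n (quotient_component n nonface_ideal) m"
      unfolding homogeneous_def quotient_component_def m by blast
    moreover have "u = 0" if u: "u \<in> polys Z" and 0: "u \<odot>\<^bsub>?M\<^esub> m = \<zero>\<^bsub>?M\<^esub>" for u
    proof -
      have "u \<in> polys {1..n}" using u Z(3) polys_mono by blast
      then have "u * monom (set_exp X) \<in> nonface_ideal"
        using 0 poly by (simp add: m smult_quotient_module[OF I] zero_quotient_module[OF I] residue_eq_iff[OF I])
      moreover have "\<forall>e\<in>keys (u * monom (set_exp X)). keys e \<in> {X..Z}"
        using multiples_set_exp_eq[OF Z(1) fin(1), where 'k = 'k] u by blast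
      \<comment> \<open>All supports lie below the face \<open>Z\<close> and hence are faces,
        whereas an element of the ideal only has nonface supports.\<close>
      ultimately have "keys (u * monom (set_exp X)) = {}"
        using subset_face[OF Z(2)] by (auto simp: nonface_ideal_def)
      then have "u * monom (set_exp X) = 0" by (simp only: keys_eq_empty)
      then show "u = 0" by (simp only: mult_monom_eq_0_iff)
    qed
    ultimately show ?thesis using poly Z by (auto simp: m carrier_quotient_module[OF I])
  qed
  have dec: "\<exists>!v. v \<in> (\<Pi>\<^sub>E i\<in>{..<length ?D}. stanley_space ?M (fst (?D ! i)) (snd (?D ! i))) \<and>
      x = (\<Oplus>\<^bsub>?M\<^esub>i\<in>{..<length ?D}. v i)" if "x \<in> carrier ?M" for x
  proof -
    obtain p where p: "p \<in> polys {1..n}" and x: "x = ?r p"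
      using \<open>x \<in> carrier ?M\<close> by (auto simp: carrier_quotient_module[OF I])
    define q where "q j = restrict_supports {A j..B j} p" for j
    have qR: "q j \<in> R j" for j by (auto simp: q_def R_def keys_restrict_supports)
    \<comment> \<open>One direction gives existence of the components of \<open>x\<close>, the other
      their uniqueness.\<close>
    have sum_iff: "x = (\<Oplus>\<^bsub>?M\<^esub>i\<in>{..<length L}. ?r (f i)) \<longleftrightarrow> (\<forall>i<length L. f i = q i)"
      if f: "\<And>i. i < length L \<Longrightarrow> f i \<in> R i" for f
    proof -
      have fI: "f i \<in> polys {1..n}" if "i < length L" for i using RI f that by blast
      have f0: "lookup (f i) e = 0" if "i < length L" "keys e \<notin> {A i..B i}" for i e
        using f[OF that(1)] that(2) by (auto simp: R_def in_keys_iff)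
      have single: "(\<Sum>i<length L. lookup (f i) e) = lookup (f j) e"
        if "j < length L" "keys e \<in> {A j..B j}" for e j
      proof -
        have "(\<Sum>i<length L. lookup (f i) e) = (\<Sum>i<length L. if i = j then lookup (f j) e else 0)"
          using that by (intro sum.cong) (auto intro!: f0 dest: unique)
        then show ?thesis using that by simp
      qed
      have "x = (\<Oplus>\<^bsub>?M\<^esub>i\<in>{..<length L}. ?r (f i)) \<longleftrightarrow> p - (\<Sum>i<length L. f i) \<in> nonface_ideal"
        unfolding x residue_eq_iff[OF I, symmetric] by (subst finsum_quotient_module[OF I]) (use fI in auto)
      \<comment> \<open>Modulo the ideal only coefficients at face supports count, and by
        \<open>single\<close> just one summand contributes to each.\<close>
      also have "\<dots> \<longleftrightarrow> (\<forall>e. keys e \<in> \<Delta> \<longrightarrow> lookup p e = (\<Sum>i<length L. lookup (f i) e))"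
      proof -
        have "p - (\<Sum>i<length L. f i) \<in> polys {1..n}"
          using p fI by (intro polys_diff polys_sum) auto
        then show ?thesis by (auto simp: nonface_ideal_def in_keys_iff lookup_minus lookup_sum)
      qed
      also have "\<dots> \<longleftrightarrow> (\<forall>i<length L. f i = q i)"
      proof (intro iffI allI impI)
        fix i assume *: "\<forall>e. keys e \<in> \<Delta> \<longrightarrow> lookup p e = (\<Sum>i<length L. lookup (f i) e)"
          and i: "i < length L"
        show "f i = q i"
        proof (rule poly_mapping_eqI)
          fix e
          show "lookup (f i) e = lookup (q i) e"
          proof (cases "keys e \<in> {A i..B i}")
            case True
            then have "keys e \<in> \<Delta>" using subset_face[OF AB(2)[OF mem[OF i]]] by auto
            with True i * show ?thesis by (simp add: q_def lookup_restrict_supports single)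
          qed (use f0[OF i] in \<open>simp add: q_def lookup_restrict_supports\<close>)
        qed
      next
        fix e :: "nat \<Rightarrow>\<^sub>0 nat" assume *: "\<forall>i<length L. f i = q i" and "keys e \<in> \<Delta>"
        then obtain j where j: "j < length L" "keys e \<in> {A j..B j}" using face by blast
        then have "lookup p e = lookup (f j) e" using * by (simp add: q_def lookup_restrict_supports)
        also have "\<dots> = (\<Sum>i<length L. lookup (f i) e)" by (rule single[OF j, symmetric])
        finally show "lookup p e = (\<Sum>i<length L. lookup (f i) e)" .
      qed
      finally show ?thesis .
    qed
    have cong: "(\<Oplus>\<^bsub>?M\<^esub>i\<in>{..<length L}. v i) = (\<Oplus>\<^bsub>?M\<^esub>i\<in>{..<length L}. ?r (f i))"
      if "\<And>i. i < length L \<Longrightarrow> v i = ?r (f i)" "\<And>i. i < length L \<Longrightarrow> f i \<in> R i" for v f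
    proof -
      interpret M: abelian_monoid ?M by (rule abelian_monoid_quotient_module[OF I])
      show ?thesis using that RI
        by (intro M.finsum_cong') (fastforce simp: carrier_quotient_module[OF I])+
    qed
    have PiE: "(\<lambda>j\<in>{..<length L}. ?r (q j)) \<in> (\<Pi>\<^sub>E i\<in>{..<length L}. ?r ` R i)"
      using qR by auto
    have sum: "x = (\<Oplus>\<^bsub>?M\<^esub>i\<in>{..<length L}. (\<lambda>j\<in>{..<length L}. ?r (q j)) i)"
      using cong[of "\<lambda>j\<in>{..<length L}. ?r (q j)" q] sum_iff[of q] qR by simp
    show ?thesis
      unfolding PiE_space unfolding length_map
    proof (rule ex1I, rule conjI[OF PiE sum])
      fix v assume vx: "v \<in> (\<Pi>\<^sub>E i\<in>{..<length L}. ?r ` R i) \<and> x = (\<Oplus>\<^bsub>?M\<^esub>i\<in>{..<length L}. v i)"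
      note v = conjunct1[OF vx] and xv = conjunct2[OF vx]
      have "\<exists>g. g \<in> R i \<and> v i = ?r g" if "i < length L" for i
        using PiE_mem[OF v, of i] that by blast
      then obtain f where f: "\<And>i. i < length L \<Longrightarrow> f i \<in> R i" "\<And>i. i < length L \<Longrightarrow> v i = ?r (f i)"
        by metis
      have "x = (\<Oplus>\<^bsub>?M\<^esub>i\<in>{..<length L}. ?r (f i))"
        unfolding xv by (rule cong) (fact f)+
      then have q: "f i = q i" if "i < length L" for i using sum_iff[OF f(1)] that by blast
      show "v = (\<lambda>j\<in>{..<length L}. ?r (q j))"
      proof (rule extensionalityI[of _ "{..<length L}"])
        show "v \<in> extensional {..<length L}" using v by (simp add: PiE_def)
      qed (use f(2) q in auto)
    qed
  qed
  show ?thesis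
    unfolding stanley_decomposition_def
  proof (intro conjI ballI case_prodI2)
    fix X m Z assume "X \<in> set ?D" "X = (m, Z)"
    then have mZ: "(m, Z) \<in> set ?D" by (simp only:)
    note * = gens[OF mZ]
    show "m \<in> carrier ?M" by (rule *[THEN conjunct1])
    show "homogeneous n (quotient_component n nonface_ideal) m"
      by (rule *[THEN conjunct2, THEN conjunct1])
    show "Z \<subseteq> {1..n}" by (rule *[THEN conjunct2, THEN conjunct2, THEN conjunct1])
    show "u \<odot>\<^bsub>?M\<^esub> m = \<zero>\<^bsub>?M\<^esub> \<longrightarrow> u = 0" if "u \<in> polys Z" for u
      by (rule *[THEN conjunct2, THEN conjunct2, THEN conjunct2, THEN bspec, OF that])
  qed (rule dec)
qed

text \<open>Homogeneity is what links freeness to supports: a representative of \<open>m\<close>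
  involves a single exponent \<open>c\<close>, so \<open>x^Z m\<close> vanishes as soon as
  \<open>Z \<union> keys c\<close> is a nonface.\<close>

lemma stanley_decomposition_facet:
  fixes gr
  defines "gr \<equiv> quotient_component n (nonface_ideal :: 'k::comm_ring_1 mpol set)"
  assumes D: "stanley_decomposition n (face_ring :: ('k mpol, _) module) gr D"
    and F: "F \<in> \<Delta>" and facet: "\<And>G. G \<in> \<Delta> \<Longrightarrow> F \<subseteq> G \<Longrightarrow> G = F"
  shows "\<exists>(m, Z)\<in>set D. Z \<subseteq> F"
proof -
  let ?r = "residue n nonface_ideal :: 'k mpol \<Rightarrow> _"
  let ?M = "face_ring :: ('k mpol, _) module"
  note I = ideal_nonface_ideal[where 'k = 'k]
  define Z where "Z i = snd (D ! i)" for i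
  note gens = D[unfolded stanley_decomposition_def, THEN conjunct1, THEN bspec, OF nth_mem,
    unfolded case_prod_beta]
  note dec = D[unfolded stanley_decomposition_def, THEN conjunct2, THEN bspec]
  have FN: "F \<subseteq> {1..n}" by (rule face_subset[OF F])
  have fF: "finite F" by (rule face_finite[OF F])
  have Z: "Z i \<subseteq> {1..n}" "finite (Z i)" if "i < length D" for i
  proof -
    show "Z i \<subseteq> {1..n}" unfolding Z_def using gens[OF that] by blast
    then show "finite (Z i)" by (rule finite_subset) simp
  qed
  \<comment> \<open>Each generator is lifted to a polynomial \<open>p i\<close> of one multidegree,
    that is, to a scalar times a monomial.\<close>
  have "\<exists>a p. p \<in> poly_component n a \<and> fst (D ! i) = ?r p" if "i < length D" for i
  proof -
    have "homogeneous n gr (fst (D ! i))"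
      using gens[OF that] by blast
    then show ?thesis unfolding homogeneous_def gr_def quotient_component_def by blast
  qed
  then obtain a p where p: "p i \<in> poly_component n (a i)" and m: "fst (D ! i) = ?r (p i)"
    if "i < length D" for i by metis
  have pN: "p i \<in> polys {1..n}" if "i < length D" for i
    using p[OF that] by (simp add: poly_component_def)
  have free: "u = 0" if "i < length D" "u \<in> polys (Z i)" "u * p i \<in> nonface_ideal" for i u
  proof -
    have "u \<in> polys {1..n}" using that(2) polys_mono[OF Z(1)[OF that(1)]] by blast
    then have "u \<odot>\<^bsub>?M\<^esub> fst (D ! i) = \<zero>\<^bsub>?M\<^esub>"
      using that(3) pN[OF that(1)]
      by (simp add: m[OF that(1)] smult_quotient_module[OF I] zero_quotient_module[OF I] residue_eq_iff[OF I])
    then show ?thesis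
      using gens[OF that(1)] that(2) unfolding Z_def by blast
  qed
  have xN: "(monom (set_exp F) :: 'k mpol) \<in> polys {1..n}"
    using FN fF by (intro polys_single) auto
  then have "?r (monom (set_exp F)) \<in> carrier ?M" by (auto simp: carrier_quotient_module[OF I])
  then obtain v where v: "v \<in> (\<Pi>\<^sub>E i\<in>{..<length D}. stanley_space ?M (fst (D ! i)) (snd (D ! i)))"
    and sum: "?r (monom (set_exp F)) = (\<Oplus>\<^bsub>?M\<^esub>i\<in>{..<length D}. v i)"
    using dec by (metis (no_types, lifting))
  have "\<exists>u. u \<in> polys (Z i) \<and> v i = ?r (u * p i)" if "i < length D" for i
  proof -
    have "v i \<in> stanley_space ?M (?r (p i)) (Z i)"
      using PiE_mem[OF v, of i] that by (simp add: m Z_def)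
    then show ?thesis
      using stanley_space_residue[OF I Z(1)[OF that] pN[OF that]] by auto
  qed
  then obtain u where u: "u i \<in> polys (Z i)" and vu: "v i = ?r (u i * p i)" if "i < length D" for i
    by metis
  have uN: "u i * p i \<in> polys {1..n}" if "i < length D" for i
    using u[OF that] polys_mono[OF Z(1)[OF that]] pN[OF that] by (intro polys_mult) auto
  have "(\<Oplus>\<^bsub>?M\<^esub>i\<in>{..<length D}. v i) = (\<Oplus>\<^bsub>?M\<^esub>i\<in>{..<length D}. ?r (u i * p i))"
  proof -
    interpret M: abelian_monoid ?M by (rule abelian_monoid_quotient_module[OF I])
    show ?thesis using vu uN
      by (intro M.finsum_cong') (auto simp: carrier_quotient_module[OF I])
  qed
  also have "\<dots> = ?r (\<Sum>i<length D. u i * p i)"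
    by (rule finsum_quotient_module[OF I]) (use uN in auto)
  finally have "monom (set_exp F) - (\<Sum>i<length D. u i * p i) \<in> nonface_ideal"
    unfolding residue_eq_iff[OF I, symmetric] sum .
  \<comment> \<open>Since \<open>F\<close> is a face, the coefficient of \<open>x^F\<close> is well
    defined modulo the ideal. Hence \<open>x^F\<close> must occur in some summand
    \<open>u i * p i\<close>.\<close>
  then have "lookup (monom (set_exp F) - (\<Sum>i<length D. u i * p i)) (set_exp F) = 0"
    by (rule lookup_nonface_ideal) (simp only: keys_set_exp[OF fF] F)
  then have "(\<Sum>i<length D. lookup (u i * p i) (set_exp F)) = 1"
    by (simp only: lookup_minus lookup_sum lookup_single_eq right_minus_eq)
  then have "(\<Sum>i<length D. lookup (u i * p i) (set_exp F)) \<noteq> 0" by (simp only: one_neq_zero not_False_eq_True)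
  then obtain i where i: "i \<in> {..<length D}" and ne: "lookup (u i * p i) (set_exp F) \<noteq> 0"
    by (rule sum.not_neutral_contains_not_neutral)
  from i have i: "i < length D" by (simp only: lessThan_iff)
  from ne have "set_exp F \<in> keys (u i * p i)" by (simp only: in_keys_iff not_False_eq_True)
  then obtain b c where bc: "b \<in> keys (u i)" "c \<in> keys (p i)" "set_exp F = b + c"
    using keys_mult[of "u i" "p i"] by blast
  have Fbc: "F = keys b \<union> keys c" using fF bc(3) by (metis keys_plus_nat keys_set_exp)
  \<comment> \<open>Otherwise the nonzero element \<open>x^Z\<close> of \<open>K[Z]\<close> would
    annihilate the generator.\<close>
  have "Z i \<union> keys c \<in> \<Delta>"
  proof (rule ccontr)
    assume no: "Z i \<union> keys c \<notin> \<Delta>"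
    have "keys e \<notin> \<Delta>" if "e \<in> keys (monom (set_exp (Z i)) * p i)" for e
    proof -
      from that obtain c' where c': "c' \<in> keys (p i)" "e = c' + set_exp (Z i)"
        by (auto simp: mult.commute[of _ "p i"] keys_mult_monom)
      then have "int (lookup c' j) = int (lookup c j)" for j
        using p[OF i] bc(2) by (simp add: poly_component_def)
      then have "c' = c" by (intro poly_mapping_eqI) simp
      with c' no Z(2)[OF i] show ?thesis by (simp add: keys_plus_nat Un_commute)
    qed
    moreover have mono: "(monom (set_exp (Z i)) :: 'k mpol) \<in> polys (Z i)"
      using Z(2)[OF i] by (intro polys_single) simp
    moreover have "monom (set_exp (Z i)) * p i \<in> polys {1..n}"
      using mono polys_mono[OF Z(1)[OF i]] pN[OF i] by (intro polys_mult) auto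
    ultimately have "(monom (set_exp (Z i)) :: 'k mpol) = 0"
      by (intro free[OF i]) (auto simp: nonface_ideal_def)
    then show False by simp
  qed
  \<comment> \<open>Therefore \<open>F = keys b \<union> keys c\<close> is contained in the face
    \<open>Z i \<union> keys c\<close>, and maximality of \<open>F\<close> forces equality.\<close>
  moreover have "keys b \<subseteq> Z i" using u[OF i] bc(1) by (simp add: polys_def)
  ultimately have "Z i \<union> keys c = F" using Fbc by (intro facet) auto
  then show ?thesis using nth_mem[OF i] by (auto simp: Z_def intro!: bexI[of _ "D ! i"])
qed

lemma sdepth_nonface_ideal_bounds:
  assumes P: "interval_partition P d \<Delta>"
    and F: "F \<in> \<Delta>" "\<And>G. G \<in> \<Delta> \<Longrightarrow> F \<subseteq> G \<Longrightarrow> G = F"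
  shows "d \<le> sdepth_quotient n (nonface_ideal :: 'k::comm_ring_1 mpol set)"
    and "sdepth_quotient n (nonface_ideal :: 'k::comm_ring_1 mpol set) \<le> card F"
proof -
  define S where "S = {sdepth_decomposition D | D. stanley_decomposition n
    (face_ring :: ('k mpol, _) module) (quotient_component n nonface_ideal) D}"
  have sdepth: "sdepth_quotient n (nonface_ideal :: 'k mpol set) = Max S"
    by (simp add: sdepth_quotient_def sdepth_def S_def)
  have fF: "finite F" by (rule face_finite[OF F(1)])
  have le: "s \<le> card F" if s: "s \<in> S" for s
  proof -
    obtain D where s: "s = sdepth_decomposition D" and D: "stanley_decomposition n
        (face_ring :: ('k mpol, _) module) (quotient_component n nonface_ideal) D"
      using s unfolding S_def by blast
    obtain m Z where "(m, Z) \<in> set D" "Z \<subseteq> F"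
      using stanley_decomposition_facet[OF D F] by blast
    then have "s \<le> card Z" unfolding s sdepth_decomposition_def by (intro Min_le) force+
    also have "\<dots> \<le> card F" by (rule card_mono[OF fF \<open>Z \<subseteq> F\<close>])
    finally show ?thesis .
  qed
  \<comment> \<open>\<open>Max\<close> is meaningful only on finite nonempty sets: the facet bounds
    \<open>S\<close>, and the partition \<open>P\<close> provides an element.\<close>
  have fin: "finite S" by (rule finite_subset[of _ "{..card F}"]) (auto dest: le)
  obtain L where L: "set L = P" "distinct L"
    using finite_distinct_list[OF interval_partition_finite[OF P]] by blast
  define D where
    "D = map (\<lambda>(A, B). (residue n nonface_ideal (monom (set_exp A) :: 'k mpol), B)) L"
  have mem: "sdepth_decomposition D \<in> S"
    using stanley_decomposition_interval_partition[OF P L, where 'k = 'k] unfolding S_def D_def by blast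
  have "P \<noteq> {}" using interval_partition_covers[OF P, of F] F(1) by auto
  then have "d \<le> sdepth_decomposition D"
    unfolding sdepth_decomposition_def D_def using L(1) interval_partition_mem(4)[OF P]
    by (subst Min_ge_iff) (auto simp: case_prod_beta)
  also have "\<dots> \<le> Max S" by (rule Max_ge[OF fin mem])
  finally show "d \<le> sdepth_quotient n (nonface_ideal :: 'k mpol set)" by (simp add: sdepth)
  show "sdepth_quotient n (nonface_ideal :: 'k mpol set) \<le> card F"
    unfolding sdepth using le fin mem by (subst Max_le_iff) auto
qed

end

section \<open>The edge ideal of a cycle\<close>

lemma simplicial_complex_cycle_faces: "simplicial_complex n (cycle_faces n)"
  by unfold_locales (auto simp: cycle_faces_def)

lemma var_mult_var: "i \<noteq> j \<Longrightarrow> (var i * var j :: 'k::comm_ring_1 mpol) = monom (set_exp {i, j})"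
  by (simp add: var_def mult_single set_exp_def)

text \<open>The generators are the monomials of the edges, which are nonfaces. Conversely, the
  support of each term of an element of the nonface ideal contains an edge, so the term is a
  multiple of a generator.\<close>

lemma cycle_ideal_eq_nonface_ideal:
  assumes "n \<ge> 3"
  shows "(cycle_ideal n :: 'k::comm_ring_1 mpol set) =
    simplicial_complex.nonface_ideal n (cycle_faces n)"
proof -
  interpret simplicial_complex n "cycle_faces n" by (rule simplicial_complex_cycle_faces)
  interpret cring "poly_ring n :: 'k mpol ring" by (rule cring_poly_ring)
  \<comment> \<open>The edges of the cycle as vertex sets. Since \<open>n \<ge> 3\<close>, the ends
    \<open>n\<close> and 1 differ, and the generators are the squarefree monomials
    \<open>x^e\<close> with \<open>e\<close> in \<open>E\<close>.\<close>
  define E where "E = {{i, i + 1} | i. i \<in> {1..<n}} \<union> {{n, 1}}"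
  have gens: "{var i * var (i + 1) | i. i \<in> {1..<n}} \<union> {var n * var 1} =
      (\<lambda>e. monom (set_exp e) :: 'k mpol) ` E"
    using assms by (auto simp: E_def var_mult_var image_Un)
  have E: "finite e" "e \<subseteq> {1..n}" "e \<notin> cycle_faces n" if "e \<in> E" for e
    using that assms by (auto simp: E_def cycle_faces_def)
  have carr: "(\<lambda>e. monom (set_exp e) :: 'k mpol) ` E \<subseteq> carrier (poly_ring n)"
  proof (rule image_subsetI)
    fix e assume "e \<in> E"
    from E[OF this] show "(monom (set_exp e) :: 'k mpol) \<in> carrier (poly_ring n)"
      by (simp add: poly_ring_def polys_single)
  qed
  let ?I = "Idl\<^bsub>poly_ring n\<^esub> ((\<lambda>e. monom (set_exp e) :: 'k mpol) ` E)"
  have I: "ideal ?I (poly_ring n)" by (rule genideal_ideal[OF carr])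
  have "?I \<subseteq> nonface_ideal"
  proof (rule genideal_minimal[OF ideal_nonface_ideal])
    show "(\<lambda>e. monom (set_exp e) :: 'k mpol) ` E \<subseteq> nonface_ideal"
    proof (rule image_subsetI)
      fix e assume "e \<in> E"
      from E[OF this] show "(monom (set_exp e) :: 'k mpol) \<in> nonface_ideal"
        by (simp add: nonface_ideal_def polys_single)
    qed
  qed
  moreover have "p \<in> ?I" if p: "p \<in> nonface_ideal" for p :: "'k mpol"
  proof -
    have "Poly_Mapping.single e c \<in> ?I" if e_p: "e \<in> keys p" for e c
    proof -
      have e: "keys e \<subseteq> {1..n}" "keys e \<notin> cycle_faces n"
        using p e_p by (auto simp: nonface_ideal_def polys_def)
      then consider i where "i \<in> keys e" "Suc i \<in> keys e" | "n \<in> keys e" "1 \<in> keys e"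
        by (auto simp: cycle_faces_def)
      then obtain A where A: "A \<in> E" "A \<subseteq> keys e"
      proof cases
        case (1 i)
        then have "{i, i + 1} \<in> E" using e(1) unfolding E_def by fastforce
        with 1 that show ?thesis by auto
      next
        case 2
        then show ?thesis using that[of "{n, 1}"] by (auto simp: E_def)
      qed
      have "Poly_Mapping.single (e - set_exp A) c * monom (set_exp A) \<in> ?I"
      proof (rule ideal_mult[OF I])
        show "monom (set_exp A) \<in> ?I" using A(1) genideal_self[OF carr] by blast
        show "Poly_Mapping.single (e - set_exp A) c \<in> polys {1..n}"
          using e(1) by (intro polys_single) (auto simp: in_keys_iff lookup_minus subset_iff)
      qed
      then show ?thesis by (simp add: mult_single diff_add_set_exp[OF A(2)])
    qed
    then have "(\<Sum>e\<in>keys p. Poly_Mapping.single e (lookup p e)) \<in> ?I" by (intro ideal_sum[OF I])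
    then show ?thesis by (simp add: sum_monomials)
  qed
  ultimately show ?thesis unfolding cycle_ideal_def gens by blast
qed

theorem theorem1p9:
  fixes n :: nat
  assumes "n \<ge> 3"
  shows "(n mod 3 = 0 \<or> n mod 3 = 2 \<longrightarrow>
            int (sdepth_quotient n (cycle_ideal n :: ('k::field) mpol set)) = \<lceil>(real n - 1) / 3\<rceil>) \<and>
         (n mod 3 = 1 \<longrightarrow>
            int (sdepth_quotient n (cycle_ideal n :: 'k mpol set)) \<le> \<lceil>real n / 3\<rceil>)"
proof -
  interpret simplicial_complex n "cycle_faces n" by (rule simplicial_complex_cycle_faces)
  let ?s = "sdepth_quotient n (cycle_ideal n :: 'k mpol set)"
  obtain P where P: "interval_partition P ((n + 1) div 3) (cycle_faces n)"
    using ex_interval_partition_cycle[OF assms] by blast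
  obtain F where F: "F \<in> cycle_faces n" "card F = (n + 2) div 3"
      "\<And>G. G \<in> cycle_faces n \<Longrightarrow> F \<subseteq> G \<Longrightarrow> G = F"
    using ex_cycle_facet[OF assms] by blast
  \<comment> \<open>The two bounds coincide unless \<open>n mod 3 = 1\<close>, where they differ by
    one; hence only an inequality in that case.\<close>
  have s: "(n + 1) div 3 \<le> ?s" "?s \<le> (n + 2) div 3"
    using sdepth_nonface_ideal_bounds[OF P F(1,3), where 'k = 'k]
    by (simp_all add: cycle_ideal_eq_nonface_ideal[OF assms] F(2))
  obtain k r where n: "n = 3 * k + r" and r: "r < 3"
    using that[of "n div 3" "n mod 3"] by simp
  consider "r = 0" | "r = 1" | "r = 2" using r by linarith
  then show ?thesis
  proof cases
    case 1
    with s n have "?s = k" by simp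
    moreover have "\<lceil>(real n - 1) / 3\<rceil> = int k" using n 1 by (intro ceiling_unique) auto
    ultimately show ?thesis using n 1 by simp
  next
    case 2
    with s n have "?s \<le> Suc k" by simp
    moreover have "\<lceil>real n / 3\<rceil> = int (Suc k)" using n 2 by (intro ceiling_unique) auto
    ultimately show ?thesis using n 2 by simp
  next
    case 3
    with s n have "?s = Suc k" by simp
    moreover have "\<lceil>(real n - 1) / 3\<rceil> = int (Suc k)" using n 3 by (intro ceiling_unique) auto
    moreover have "n mod 3 = 2" using n 3 by presburger
    ultimately show ?thesis by simp
  qed
qed

end
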